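(* Consider the constrained problem $$\min_{x\in\mathcal X} f(x)\quad\text{subject to } c_i(x)=0\ (i\in\mathcal E),\quad c_i(x)\ge 0\ (i\in\mathcal I),$$ with feasible set $\Omega$, and let $x^\ast\in\Omega$ be a feasible point. 1. If the constraint functions $c_i$, $i\in\mathcal E\cup\mathcal I$, are all differentiable at $x^\ast$, then $T_\Omega(x^\ast)\subset\mathcal F(x^\ast)$. 2. Suppose $\mathcal X=\mathbb R^n$. If the constraint functions $c_i$, $i\in\mathcal E\cup\mathcal I$, are all continuously differentiable at $x^\ast$ and the linear independence constraint qualification (LICQ) holds at $x^\ast$, then $\mathcal F(x^\ast)\subset T_\Omega(x^\ast)$. Furthermore, in this case $\mathcal F(x^\ast)=T_\Omega(x^\ast)$.
   Context: Setting: $\mathcal X\subseteq\mathbb R^n$ is a set, $\mathcal E$ and $\mathcal I$ are disjoint finite index sets, and $f:\mathbb R^n\to\mathbb R$ and $c_i:\mathbb R^n\to\mathbb R$ ($i\in\mathcal E\cup\mathcal I$) are real-valued functions. The feasible set is $\Omega=\{x\in\mathcal X : c_i(x)=0\ \forall i\in\mathcal E,\ c_i(x)\ge 0\ \forall i\in\mathcal I\}$. "Continuously differentiable at $x^\ast$" means $C^1$ in a neighborhood of $x^\ast$. Tangent cone: a vector $d$ is a tangent vector to $\Omega$ at $x$ if there exist a feasible sequence $\{z_k\}$ (that is, $z_k\in\Omega$ for all sufficiently large $k$) converging to $x$ and a sequence of positive scalars $t_k\to 0$ with $\lim_{k\to\infty}(z_k-x)/t_k=d$. The set of all tangent vectors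 to $\Omega$ at $x$ is denoted $T_\Omega(x)$. Active set: for feasible $x$, $\mathcal A(x)=\mathcal E\cup\{i\in\mathcal I : c_i(x)=0\}$. Linearized feasible directions: $\mathcal F(x)=\{d\in\mathbb R^n : d^\top\nabla c_i(x)=0\ \forall i\in\mathcal E,\ d^\top\nabla c_i(x)\ge 0\ \forall i\in\mathcal A(x)\cap\mathcal I\}$. LICQ holds at $x$ if the family of active constraint gradients $(\nabla c_i(x))_{i\in\mathcal A(x)}$ is linearly independent. *)

theory Defs
  imports "HOL-Analysis.Analysis"
begin

definition feasible_set ::
  "'a set \<Rightarrow> 'i set \<Rightarrow> 'i set \<Rightarrow> ('i \<Rightarrow> 'a \<Rightarrow> real) \<Rightarrow> 'a set" where
  "feasible_set X E I c = {x \<in> X. (\<forall>i\<in>E. c i x = 0) \<and> (\<forall>i\<in>I. c i x \<ge> 0)}"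

text \<open>Unspecified where \<open>f\<close> is not differentiable; see \<open>differentiable_imp_gderiv_gradient\<close>.\<close>

definition gradient :: "('a::euclidean_space \<Rightarrow> real) \<Rightarrow> 'a \<Rightarrow> 'a" where
  "gradient f x = (THE D. GDERIV f x :> D)"

lemma gradient_eqI:
  assumes "GDERIV f x :> D"
  shows "gradient f x = D"
  unfolding gradient_def
proof (rule the_equality)
  fix D' assume "GDERIV f x :> D'"
  with assms have "(\<lambda>h. h \<bullet> D') = (\<lambda>h. h \<bullet> D)"
    unfolding gderiv_def by (rule has_derivative_unique[rotated])
  then have "\<And>h. h \<bullet> D' = h \<bullet> D"
    by (rule fun_cong)
  then show "D' = D"
    using vector_eq_ldot by blast
qed (fact assms)

lemma differentiable_imp_gderiv_gradient:
  assumes "f differentiable (at x)"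
  shows "GDERIV f x :> gradient f x"
proof -
  obtain f' where f': "(f has_derivative f') (at x)"
    using assms by (auto simp: differentiable_def)
  then have "linear f'"
    by (rule has_derivative_linear)
  then have "f' = (\<lambda>h. h \<bullet> adjoint f' 1)"
    by (simp add: fun_eq_iff adjoint_works)
  with f' have "GDERIV f x :> adjoint f' 1"
    unfolding gderiv_def by simp
  then show ?thesis
    using gradient_eqI by metis
qed

text \<open>\<open>C\<^sup>1\<close> on a whole neighbourhood of the point, not merely differentiable there with
  a gradient that is continuous at the point.\<close>

definition continuously_differentiable_at ::
  "('a::euclidean_space \<Rightarrow> real) \<Rightarrow> 'a \<Rightarrow> bool" where
  "continuously_differentiable_at f x \<longleftrightarrow>
     (\<exists>U. open U \<and> x \<in> U \<and> (\<forall>y\<in>U. f differentiable (at y)) \<and> continuous_on U (gradient f))"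

definition tangent_cone :: "'a::real_normed_vector set \<Rightarrow> 'a \<Rightarrow> 'a set" where
  "tangent_cone S x = {d. \<exists>z t.
     (\<forall>\<^sub>F k in sequentially. z k \<in> S) \<and> z \<longlonglongrightarrow> x \<and>
     (\<forall>k::nat. t k > (0::real)) \<and> t \<longlonglongrightarrow> 0 \<and>
     (\<lambda>k. (z k - x) /\<^sub>R t k) \<longlonglongrightarrow> d}"

definition active_set ::
  "'i set \<Rightarrow> 'i set \<Rightarrow> ('i \<Rightarrow> 'a \<Rightarrow> real) \<Rightarrow> 'a \<Rightarrow> 'i set" where
  "active_set E I c x = E \<union> {i \<in> I. c i x = 0}"

definition linearized_feasible_directions ::
  "'i set \<Rightarrow> 'i set \<Rightarrow> ('i \<Rightarrow> 'a::euclidean_space \<Rightarrow> real) \<Rightarrow> 'a \<Rightarrow> 'a set" where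
  "linearized_feasible_directions E I c x =
     {d. (\<forall>i\<in>E. d \<bullet> gradient (c i) x = 0) \<and>
         (\<forall>i\<in>active_set E I c x \<inter> I. d \<bullet> gradient (c i) x \<ge> 0)}"

text \<open>Independence of an indexed family: unlike \<^term>\<open>independent (v ` A)\<close>, it fails
  when two distinct indices carry the same vector.\<close>

definition independent_family :: "('i \<Rightarrow> 'a::real_vector) \<Rightarrow> 'i set \<Rightarrow> bool" where
  "independent_family v A \<longleftrightarrow>
     (\<forall>J u. finite J \<longrightarrow> J \<subseteq> A \<longrightarrow> (\<Sum>i\<in>J. u i *\<^sub>R v i) = 0 \<longrightarrow> (\<forall>i\<in>J. u i = 0))"

definition LICQ ::
  "'i set \<Rightarrow> 'i set \<Rightarrow> ('i \<Rightarrow> 'a::euclidean_space \<Rightarrow> real) \<Rightarrow> 'a \<Rightarrow> bool" where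
  "LICQ E I c x \<longleftrightarrow> independent_family (\<lambda>i. gradient (c i) x) (active_set E I c x)"

end

theory Submission
  imports Defs
begin

text \<open>
  The inclusion \<open>T\<^sub>\<Omega> \<subseteq> \<F>\<close> is the chain rule along a feasible sequence: if \<open>(z\<^sub>k - x) / t\<^sub>k \<rightarrow> d\<close>
  then the difference quotients \<open>(c\<^sub>i(z\<^sub>k) - c\<^sub>i(x)) / t\<^sub>k\<close> tend to \<open>d \<bullet> \<nabla>c\<^sub>i(x)\<close>
  (\<open>difference_quotient_along_sequence\<close>), and feasibility of \<open>z\<^sub>k\<close> makes these
  quotients zero for equality constraints and nonnegative for active inequality constraints.

  For the converse, a direction \<open>d \<in> \<F>\<close> must be realised by feasible points. It suffices to find
  \<open>z\<^sub>k\<close> with \<open>(z\<^sub>k - x) / t\<^sub>k \<rightarrow> d\<close> on which every active constraint takes exactly the value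
  \<open>t\<^sub>k (d \<bullet> \<nabla>c\<^sub>i(x))\<close> that its linearization prescribes; the inactive constraints stay positive by
  continuity, and with \<open>X\<close> the whole space nothing else is required of \<open>z\<^sub>k\<close>.

  Write \<open>g\<^sub>i = \<nabla>c\<^sub>i(x)\<close> for active \<open>i\<close>. Independence of the \<open>g\<^sub>i\<close> yields a
  dual family \<open>h\<^sub>i\<close> with \<open>h\<^sub>i \<bullet> g\<^sub>j = \<delta>\<^sub>i\<^sub>j\<close>, and the map
  \[ F(y) = y + \sum_i (c_i(y) - c_i(x) - (y - x) \bullet g_i)\, h_i \]
  turns the nonlinear constraints into linear ones: \<open>(F(y) - x) \<bullet> g\<^sub>j = c\<^sub>j(y) - c\<^sub>j(x)\<close>. Hence it is
  enough to solve \<open>F(z\<^sub>k) = x + t\<^sub>k d\<close>. The map \<open>F\<close> fixes \<open>x\<close>, is continuous near \<open>x\<close>, and has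
  derivative the identity there, so for small \<open>t\<^sub>k\<close> Brouwer's fixed point theorem solves
  this equation with
  \<open>\<parallel>z\<^sub>k - x\<parallel> \<le> 2 t\<^sub>k \<parallel>d\<parallel>\<close> (\<open>solvable_near_identity_derivative\<close>), and differentiability at \<open>x\<close>
  then forces \<open>(z\<^sub>k - x) / t\<^sub>k \<rightarrow> d\<close>.
\<close>

section \<open>Differentiation along convergent sequences\<close>

text \<open>Where \<open>z k = x\<close> the quotient is \<open>0 / 0 = 0\<close>, so the sequence may return to \<open>x\<close>.\<close>

lemma has_derivative_remainder_tendsto_0:
  fixes F :: "'a::real_normed_vector \<Rightarrow> 'b::real_normed_vector"
  assumes F: "(F has_derivative F') (at x)" and z: "z \<longlonglongrightarrow> x"
  shows "(\<lambda>k. norm (F (z k) - F x - F' (z k - x)) / norm (z k - x)) \<longlonglongrightarrow> 0"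
proof -
  let ?r = "\<lambda>h. norm (F (x + h) - F x - F' h) / norm h"
  have "(?r \<longlongrightarrow> 0) (at 0)"
    using F by (simp add: has_derivative_at)
  then have "isCont ?r 0"
    by (simp add: isCont_def)
  moreover have "(\<lambda>k. z k - x) \<longlonglongrightarrow> 0"
    using z by (simp add: LIM_zero)
  ultimately have "(\<lambda>k. ?r (z k - x)) \<longlonglongrightarrow> ?r 0"
    by (rule isCont_tendsto_compose)
  then show ?thesis
    by simp
qed

lemma difference_quotient_along_sequence:
  fixes F :: "'a::real_normed_vector \<Rightarrow> 'b::real_normed_vector"
  assumes F: "(F has_derivative F') (at x)" and z: "z \<longlonglongrightarrow> x"
    and t: "\<And>k. t k > (0::real)" and d: "(\<lambda>k. (z k - x) /\<^sub>R t k) \<longlonglongrightarrow> d"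
  shows "(\<lambda>k. (F (z k) - F x) /\<^sub>R t k) \<longlonglongrightarrow> F' d"
proof -
  interpret F': bounded_linear F'
    using F by (rule has_derivative_bounded_linear)
  let ?R = "\<lambda>k. F (z k) - F x - F' (z k - x)"
  have "(\<lambda>k. norm (?R k) / norm (z k - x) * norm ((z k - x) /\<^sub>R t k)) \<longlonglongrightarrow> 0 * norm d"
    by (intro tendsto_mult tendsto_norm d has_derivative_remainder_tendsto_0 F z)
  moreover have "norm (?R k) / norm (z k - x) * norm ((z k - x) /\<^sub>R t k) = norm (?R k /\<^sub>R t k)" for k
    using t[of k] by (cases "z k = x") (simp_all add: F'.zero)
  ultimately have "(\<lambda>k. norm (?R k /\<^sub>R t k)) \<longlonglongrightarrow> 0"
    by (simp only: mult_zero_left)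
  then have "(\<lambda>k. ?R k /\<^sub>R t k) \<longlonglongrightarrow> 0"
    by (rule tendsto_norm_zero_cancel)
  moreover have "(\<lambda>k. F' ((z k - x) /\<^sub>R t k)) \<longlonglongrightarrow> F' d"
    by (rule F'.tendsto[OF d])
  ultimately have "(\<lambda>k. ?R k /\<^sub>R t k + F' ((z k - x) /\<^sub>R t k)) \<longlonglongrightarrow> 0 + F' d"
    by (rule tendsto_add)
  then show ?thesis
    by (simp add: F'.scaleR flip: scaleR_add_right)
qed

section \<open>Tangent vectors are linearized feasible directions\<close>

lemma tangent_cone_subset_linearized:
  assumes diff: "\<forall>i\<in>E \<union> I. c i differentiable (at x)"
    and x: "x \<in> feasible_set X E I c"
  shows "tangent_cone (feasible_set X E I c) x \<subseteq> linearized_feasible_directions E I c x"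
proof
  fix d assume "d \<in> tangent_cone (feasible_set X E I c) x"
  then obtain z t where feas: "\<forall>\<^sub>F k in sequentially. z k \<in> feasible_set X E I c"
    and z: "z \<longlonglongrightarrow> x" and t: "\<And>k::nat. t k > (0::real)"
    and d: "(\<lambda>k. (z k - x) /\<^sub>R t k) \<longlonglongrightarrow> d"
    unfolding tangent_cone_def by blast
  have lim: "(\<lambda>k. (c i (z k) - c i x) /\<^sub>R t k) \<longlonglongrightarrow> d \<bullet> gradient (c i) x" if "i \<in> E \<union> I" for i
    using differentiable_imp_gderiv_gradient[of "c i" x] diff that
    by (intro difference_quotient_along_sequence[OF _ z t d]) (auto simp: gderiv_def)
  have "d \<bullet> gradient (c i) x = 0" if i: "i \<in> E" for i
  proof -
    have "\<forall>\<^sub>F k in sequentially. (c i (z k) - c i x) /\<^sub>R t k = 0"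
      using feas x i by (auto simp: feasible_set_def elim!: eventually_mono)
    then have "(\<lambda>k. (c i (z k) - c i x) /\<^sub>R t k) \<longlonglongrightarrow> 0"
      by (rule tendsto_eventually)
    with lim i show ?thesis
      by (metis LIMSEQ_unique UnI1)
  qed
  moreover have "d \<bullet> gradient (c i) x \<ge> 0" if i: "i \<in> active_set E I c x \<inter> I" for i
  proof -
    have "c i x = 0"
      using i x by (auto simp: active_set_def feasible_set_def)
    then have "\<forall>\<^sub>F k in sequentially. (c i (z k) - c i x) /\<^sub>R t k \<ge> 0"
      using feas i t by (auto simp: feasible_set_def less_imp_le elim!: eventually_mono)
    with lim[of i] i show ?thesis
      by (intro tendsto_lowerbound) auto
  qed
  ultimately show "d \<in> linearized_feasible_directions E I c x"
    by (simp add: linearized_feasible_directions_def)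
qed

section \<open>Sequences with prescribed constraint values\<close>

text \<open>
  Independence lets one prescribe the value \<open>\<delta>\<^sub>i\<^sub>j\<close> of a linear functional at each \<open>g j\<close>; its
  Riesz representative is \<open>h i\<close>.
\<close>

lemma independent_family_dual:
  fixes g :: "'i \<Rightarrow> 'a::euclidean_space"
  assumes fin: "finite A" and ind: "independent_family g A"
  obtains h where "\<And>i j. i \<in> A \<Longrightarrow> j \<in> A \<Longrightarrow> h i \<bullet> g j = (if i = j then 1 else 0)"
proof -
  have inj: "inj_on g A"
  proof (rule inj_onI, rule ccontr)
    fix i j assume ij: "i \<in> A" "j \<in> A" "g i = g j" "i \<noteq> j"
    define u where "u k = (if k = i then 1 else - 1 :: real)" for k
    have "(\<Sum>k\<in>{i, j}. u k *\<^sub>R g k) = 0"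
      using ij by (simp add: u_def)
    then have "\<forall>k\<in>{i, j}. u k = 0"
      using ind ij unfolding independent_family_def by (metis empty_subsetI finite.intros insert_subset)
    then show False
      by (simp add: u_def)
  qed
  have "independent (g ` A)"
  proof (rule independent_if_scalars_zero)
    fix f v assume "(\<Sum>v\<in>g ` A. f v *\<^sub>R v) = 0" and v: "v \<in> g ` A"
    then have "(\<Sum>i\<in>A. f (g i) *\<^sub>R g i) = 0"
      using inj by (simp add: sum.reindex)
    moreover have "\<And>u. (\<Sum>i\<in>A. u i *\<^sub>R g i) = 0 \<Longrightarrow> \<forall>i\<in>A. u i = 0"
      using ind fin unfolding independent_family_def by blast
    ultimately show "f v = 0"
      using v by fastforce
  qed (use fin in simp)
  then have "\<exists>w. \<forall>j\<in>A. w \<bullet> g j = (if i = j then 1 else 0)" if "i \<in> A" for i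
  proof -
    obtain \<phi> :: "'a \<Rightarrow> real" where \<phi>: "linear \<phi>"
      and val: "\<And>v. v \<in> g ` A \<Longrightarrow> \<phi> v = (if v = g i then 1 else 0)"
      using linear_independent_extend[OF \<open>independent (g ` A)\<close>, of "\<lambda>v. if v = g i then 1 else 0"]
      by blast
    have "adjoint \<phi> 1 \<bullet> g j = (if i = j then 1 else 0)" if "j \<in> A" for j
      using adjoint_works[OF \<phi>, of "g j" 1] val[of "g j"] inj \<open>i \<in> A\<close> that
      by (auto simp: inner_commute inj_on_eq_iff)
    then show ?thesis
      by blast
  qed
  then show thesis
    using that by metis
qed

text \<open>
  Near \<open>x\<close> the error \<open>F y - F x - (y - x)\<close> is at most half of \<open>norm (y - x)\<close>, so
  \<open>y \<mapsto> y + (F x + h - F y)\<close> maps the ball of radius \<open>2 * norm h\<close> around \<open>x\<close> into itself. Its fixed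
  points solve \<open>F y = F x + h\<close>.
\<close>

lemma solvable_near_identity_derivative:
  fixes F :: "'a::euclidean_space \<Rightarrow> 'a"
  assumes U: "open U" "x \<in> U" and cont: "continuous_on U F"
    and deriv: "(F has_derivative (\<lambda>h. h)) (at x)"
  obtains \<delta> where "\<delta> > 0"
    and "\<And>h. norm h < \<delta> \<Longrightarrow> \<exists>y. norm (y - x) \<le> 2 * norm h \<and> F y = F x + h"
proof -
  obtain r where r: "r > 0" "cball x r \<subseteq> U"
    using U open_contains_cball by blast
  obtain s where s: "s > 0"
    and err: "\<And>y. norm (y - x) < s \<Longrightarrow> norm (F y - F x - (y - x)) \<le> 1/2 * norm (y - x)"
    using deriv unfolding has_derivative_at_alt by (meson half_gt_zero zero_less_one)
  show thesis
  proof
    show "min (r / 2) (s / 2) > 0"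
      using r s by simp
    fix h :: 'a assume h: "norm h < min (r / 2) (s / 2)"
    let ?B = "cball x (2 * norm h)"
    have "\<exists>y\<in>?B. F y = F x + h"
    proof (rule brouwer_surjective[where S = "{F x + h}"])
      show "continuous_on ?B F"
        using h r by (intro continuous_on_subset[OF cont]) (auto simp: subset_iff)
      fix p y assume p: "p \<in> {F x + h}" and y: "y \<in> ?B"
      have "norm (y - x) \<le> 2 * norm h"
        using y by (simp add: dist_norm norm_minus_commute)
      then have "norm (F y - F x - (y - x)) \<le> norm h"
        using err[of y] h by simp
      then have "norm (h - (F y - F x - (y - x))) \<le> 2 * norm h"
        using norm_triangle_ineq4[of h "F y - F x - (y - x)"] by linarith
      then show "p + (y - F y) \<in> ?B"
        using p by (simp add: dist_norm norm_minus_commute algebra_simps)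
    qed auto
    then show "\<exists>y. norm (y - x) \<le> 2 * norm h \<and> F y = F x + h"
      by (auto simp: dist_norm norm_minus_commute)
  qed
qed

text \<open>
  The map \<open>F\<close> below straightens all the functions \<open>c i\<close> at once, so that a solution of
  \<open>F (z k) = x + t k *\<^sub>R d\<close> gives them their linearized values without error.
\<close>

lemma follow_linearization:
  fixes c :: "'i \<Rightarrow> 'a::euclidean_space \<Rightarrow> real"
  assumes A: "finite A" "independent_family g A"
    and U: "open U" "x \<in> U" and cont: "\<And>i. i \<in> A \<Longrightarrow> continuous_on U (c i)"
    and deriv: "\<And>i. i \<in> A \<Longrightarrow> GDERIV (c i) x :> g i"
  obtains z t where "z \<longlonglongrightarrow> x" "\<And>k::nat. t k > (0::real)" "t \<longlonglongrightarrow> 0"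
    "(\<lambda>k. (z k - x) /\<^sub>R t k) \<longlonglongrightarrow> d"
    "\<And>i k. i \<in> A \<Longrightarrow> c i (z k) = c i x + t k * (d \<bullet> g i)"
proof -
  obtain h where h: "\<And>i j. i \<in> A \<Longrightarrow> j \<in> A \<Longrightarrow> h i \<bullet> g j = (if i = j then 1 else 0)"
    using independent_family_dual[OF A] by blast
  define F where "F y = y + (\<Sum>i\<in>A. (c i y - c i x - (y - x) \<bullet> g i) *\<^sub>R h i)" for y
  have Fx: "F x = x"
    by (simp add: F_def)
  have straight: "(F y - x) \<bullet> g j = c j y - c j x" if "j \<in> A" for y j
  proof -
    have "(\<Sum>i\<in>A. (c i y - c i x - (y - x) \<bullet> g i) *\<^sub>R h i) \<bullet> g j
        = (\<Sum>i\<in>A. if i = j then c i y - c i x - (y - x) \<bullet> g i else 0)"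
      unfolding inner_sum_left using h that by (intro sum.cong) auto
    also have "\<dots> = c j y - c j x - (y - x) \<bullet> g j"
      using A that by simp
    finally show ?thesis
      by (simp add: F_def inner_diff_left inner_add_left)
  qed
  have "continuous_on U F"
    unfolding F_def by (intro continuous_intros cont)
  moreover have derivF: "(F has_derivative (\<lambda>v. v)) (at x)"
  proof -
    have "(F has_derivative (\<lambda>v. v + (\<Sum>i\<in>A. (v \<bullet> g i - 0 - (v - 0) \<bullet> g i) *\<^sub>R h i))) (at x)"
      unfolding F_def using deriv by (intro derivative_intros) (simp_all add: gderiv_def)
    then show ?thesis
      by simp
  qed
  ultimately obtain \<delta> where \<delta>: "\<delta> > 0"
    and solve: "\<And>v. norm v < \<delta> \<Longrightarrow> \<exists>y. norm (y - x) \<le> 2 * norm v \<and> F y = F x + v"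
    using solvable_near_identity_derivative[OF U] by blast
  \<comment> \<open>The constant factor keeps \<open>norm (t k *\<^sub>R d)\<close> below \<open>\<delta>\<close> for every \<open>k\<close>; adding 1 covers \<open>d = 0\<close>.\<close>
  define t where "t k = \<delta> / (norm d + 1) / real (Suc k)" for k
  have t_pos: "t k > 0" for k
    using \<delta> by (simp add: t_def add_nonneg_pos)
  have t_null: "t \<longlonglongrightarrow> 0"
    unfolding t_def by (rule LIMSEQ_Suc[OF lim_const_over_n])
  have "norm (t k *\<^sub>R d) < \<delta>" for k
  proof -
    have "\<delta> * norm d < \<delta> * ((norm d + 1) * real (Suc k))"
      using \<delta> mult_left_mono[of 1 "real (Suc k)" "norm d + 1"] by (intro mult_strict_left_mono) auto
    moreover have "(norm d + 1) * real (Suc k) > 0"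
      by (simp add: add_nonneg_pos)
    ultimately show ?thesis
      using \<delta> by (simp add: t_def divide_less_eq abs_mult add_nonneg_pos)
  qed
  then have "\<forall>k. \<exists>y. norm (y - x) \<le> 2 * norm (t k *\<^sub>R d) \<and> F y = x + t k *\<^sub>R d"
    using solve Fx by metis
  then obtain z where z_le: "\<And>k. norm (z k - x) \<le> 2 * norm (t k *\<^sub>R d)"
    and Fz: "\<And>k. F (z k) = x + t k *\<^sub>R d"
    by metis
  have "(\<lambda>k. 2 * norm (t k *\<^sub>R d)) \<longlonglongrightarrow> 2 * norm (0 *\<^sub>R d)"
    by (intro tendsto_intros t_null)
  then have "(\<lambda>k. 2 * norm (t k *\<^sub>R d)) \<longlonglongrightarrow> 0"
    by (simp only: scaleR_zero_left norm_zero mult_zero_right)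
  then have "(\<lambda>k. z k - x) \<longlonglongrightarrow> 0"
    by (rule Lim_null_comparison[OF always_eventually[OF allI[OF z_le]]])
  then have z_lim: "z \<longlonglongrightarrow> x"
    by (rule LIM_zero_cancel)
  let ?q = "\<lambda>k. norm (F (z k) - F x - (z k - x)) / norm (z k - x)"
  \<comment> \<open>The derivative of \<open>F\<close> being the identity, \<open>(z k - x) / t k - d\<close> is the scaled remainder.\<close>
  have bound: "norm ((z k - x) /\<^sub>R t k - d) \<le> ?q k * (2 * norm d)" for k
  proof -
    have "(z k - x) /\<^sub>R t k - d = - ((F (z k) - F x - (z k - x)) /\<^sub>R t k)"
      using t_pos[of k] by (simp add: Fz Fx scaleR_diff_right)
    then have "norm ((z k - x) /\<^sub>R t k - d) = norm (F (z k) - F x - (z k - x)) / t k"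
      using t_pos[of k] by (simp add: divide_inverse_commute)
    also have "\<dots> = ?q k * (norm (z k - x) / t k)"
      using Fx by (cases "z k = x") auto
    also have "\<dots> \<le> ?q k * (2 * norm d)"
      using z_le[of k] t_pos[of k] by (intro mult_left_mono) (auto simp: field_simps)
    finally show ?thesis .
  qed
  have "(\<lambda>k. ?q k * (2 * norm d)) \<longlonglongrightarrow> 0"
    by (intro tendsto_mult_left_zero has_derivative_remainder_tendsto_0[OF derivF z_lim])
  then have "(\<lambda>k. (z k - x) /\<^sub>R t k - d) \<longlonglongrightarrow> 0"
    by (rule Lim_null_comparison[OF always_eventually[OF allI[OF bound]]])
  then have "(\<lambda>k. (z k - x) /\<^sub>R t k) \<longlonglongrightarrow> d"
    by (rule LIM_zero_cancel)
  moreover have "c i (z k) = c i x + t k * (d \<bullet> g i)" if "i \<in> A" for i k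
    using straight[OF that, of "z k"] by (simp add: Fz)
  ultimately show thesis
    using that z_lim t_pos t_null by blast
qed

section \<open>Linearized feasible directions under LICQ\<close>

lemma linearized_subset_tangent_cone:
  assumes fin: "finite E" "finite I"
    and x: "x \<in> feasible_set UNIV E I c"
    and C1: "\<forall>i\<in>E \<union> I. continuously_differentiable_at (c i) x"
    and licq: "LICQ E I c x"
  shows "linearized_feasible_directions E I c x \<subseteq> tangent_cone (feasible_set UNIV E I c) x"
proof
  fix d assume d: "d \<in> linearized_feasible_directions E I c x"
  let ?A = "active_set E I c x"
  have A: "finite ?A" "?A \<subseteq> E \<union> I"
    using fin by (auto simp: active_set_def)
  have active: "c i x = 0" if "i \<in> ?A" for i
    using that x by (auto simp: active_set_def feasible_set_def)
  obtain V where V: "\<And>i. i \<in> E \<union> I \<Longrightarrow> open (V i)" "\<And>i. i \<in> E \<union> I \<Longrightarrow> x \<in> V i"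
    and diff: "\<And>i y. i \<in> E \<union> I \<Longrightarrow> y \<in> V i \<Longrightarrow> c i differentiable (at y)"
    using C1 unfolding continuously_differentiable_at_def by metis
  define U where "U = (\<Inter>i\<in>E \<union> I. V i)"
  have U: "open U" "x \<in> U"
    using V fin by (auto simp: U_def intro!: open_INT)
  have cont: "continuous_on U (c i)" if "i \<in> E \<union> I" for i
    using diff that unfolding U_def
    by (intro continuous_at_imp_continuous_on ballI differentiable_imp_continuous_within) auto
  obtain z t where z: "z \<longlonglongrightarrow> x" and t: "\<And>k::nat. t k > (0::real)" "t \<longlonglongrightarrow> 0"
    and zd: "(\<lambda>k. (z k - x) /\<^sub>R t k) \<longlonglongrightarrow> d"
    and val: "\<And>i k. i \<in> ?A \<Longrightarrow> c i (z k) = c i x + t k * (d \<bullet> gradient (c i) x)"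
  proof (rule follow_linearization[of ?A "\<lambda>i. gradient (c i) x" U x c d])
    show "independent_family (\<lambda>i. gradient (c i) x) ?A"
      using licq by (simp add: LICQ_def)
    show "GDERIV (c i) x :> gradient (c i) x" if "i \<in> ?A" for i
      using that A V diff by (intro differentiable_imp_gderiv_gradient) blast
    show "continuous_on U (c i)" if "i \<in> ?A" for i
      using that A cont by blast
  qed (use A U in auto)
  have "\<forall>\<^sub>F k in sequentially. c i (z k) \<ge> 0" if i: "i \<in> I" for i
  proof (cases "i \<in> ?A")
    case True
    then have "d \<bullet> gradient (c i) x \<ge> 0"
      using d i by (simp add: linearized_feasible_directions_def)
    then show ?thesis
      using val[OF True] active[OF True] t(1) by (simp add: less_imp_le)
  next
    case False
    then have "c i x > 0"
      using i x by (auto simp: active_set_def feasible_set_def order_less_le)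
    moreover have "(\<lambda>k. c i (z k)) \<longlonglongrightarrow> c i x"
      using cont[of i] i U continuous_on_eq_continuous_at
      by (intro isCont_tendsto_compose[OF _ z]) auto
    ultimately have "\<forall>\<^sub>F k in sequentially. c i (z k) > 0"
      by (rule order_tendstoD(1)[rotated])
    then show ?thesis
      by (rule eventually_mono) simp
  qed
  then have "\<forall>\<^sub>F k in sequentially. \<forall>i\<in>I. c i (z k) \<ge> 0"
    using fin by (simp add: eventually_ball_finite)
  moreover have "c i (z k) = 0" if "i \<in> E" for i k
    using val[of i k] active[of i] d that
    by (simp add: active_set_def linearized_feasible_directions_def)
  ultimately have "\<forall>\<^sub>F k in sequentially. z k \<in> feasible_set UNIV E I c"
    by (auto simp: feasible_set_def elim!: eventually_mono)
  then show "d \<in> tangent_cone (feasible_set UNIV E I c) x"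
    unfolding tangent_cone_def using z t zd by blast
qed

theorem theorem6:
  fixes X :: "(real ^ 'n) set"
    and E I :: "'i set"
    and f :: "real ^ 'n \<Rightarrow> real"
    and c :: "'i \<Rightarrow> real ^ 'n \<Rightarrow> real"
    and xs :: "real ^ 'n"
  assumes "finite E" and "finite I" and "E \<inter> I = {}"
    and "xs \<in> feasible_set X E I c"
  shows "((\<forall>i\<in>E \<union> I. c i differentiable (at xs)) \<longrightarrow>
            tangent_cone (feasible_set X E I c) xs \<subseteq> linearized_feasible_directions E I c xs) \<and>
         (X = UNIV \<and> (\<forall>i\<in>E \<union> I. continuously_differentiable_at (c i) xs) \<and> LICQ E I c xs \<longrightarrow>
            linearized_feasible_directions E I c xs \<subseteq> tangent_cone (feasible_set X E I c) xs \<and>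
            linearized_feasible_directions E I c xs = tangent_cone (feasible_set X E I c) xs)"
proof (intro conjI impI)
  show *: "tangent_cone (feasible_set X E I c) xs \<subseteq> linearized_feasible_directions E I c xs"
    if "\<forall>i\<in>E \<union> I. c i differentiable (at xs)"
    using that assms by (intro tangent_cone_subset_linearized)
  assume C1: "X = UNIV \<and> (\<forall>i\<in>E \<union> I. continuously_differentiable_at (c i) xs) \<and> LICQ E I c xs"
  then show **: "linearized_feasible_directions E I c xs \<subseteq> tangent_cone (feasible_set X E I c) xs"
    using assms linearized_subset_tangent_cone[of E I xs c] by simp
  have "\<forall>i\<in>E \<union> I. c i differentiable (at xs)"
    using C1 unfolding continuously_differentiable_at_def by blast
  then show "linearized_feasible_directions E I c xs = tangent_cone (feasible_set X E I c) xs"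
    using * ** by blast
qed

end
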